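(* Let $N$ be a non-negative integer, $\gamma,\delta\in\mathbb{C}$, and $\lambda(x)=x(x+\gamma+\delta+1)$. For every integer $n>N$ the dual Hahn polynomials satisfy $$R_n(\lambda(x);\gamma,\delta,N)=R_{N+1}(\lambda(x);\gamma,\delta,N)\,(-1)^{n-N-1}\,S_{n-N-1}\!\left(\left(xi+i\tfrac{\gamma+\delta+1}{2}\right)^2;\ N+\tfrac{\gamma+\delta+3}{2},\ \tfrac{-\gamma-\delta+1}{2},\ \tfrac{\gamma-\delta+1}{2}\right).$$
   Context: $(a)_0=1$, $(a)_n=a(a+1)\cdots(a+n-1)$. Dual Hahn polynomials of every degree $n\ge 0$ are $R_n(\lambda(x);\gamma,\delta,N)=(\gamma+1)_n(-N)_n\,{}_3F_2\!\left(\begin{array}{c}-n,\ -x,\ x+\gamma+\delta+1\\ \gamma+1,\ -N\end{array}\Big|1\right)$, read after cancelling as $$R_n(\lambda(x);\gamma,\delta,N)=\sum_{k=0}^n\frac{(-n)_k(-x)_k(x+\gamma+\delta+1)_k}{k!}(\gamma+1+k)_{n-k}(-N+k)_{n-k}.$$ Continuous dual Hahn polynomials are $S_m(y^2;a,b,c)=(-1)^m(a+b)_m(a+c)_m\,{}_3F_2\!\left(\begin{array}{c}-m,\ a+iy,\ a-iy\\ a+b,\ a+c\end{array}\Big|1\right)$, likewise read as $$(-1)^m\sum_{k=0}^m\frac{(-m)_k(a+iy)_k(a-iy)_k}{k!}(a+b+k)_{m-k}(a+c+k)_{m-k}.$$ *)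

theory Defs
  imports "HOL-Analysis.Analysis"
begin

definition dh_lattice :: "complex \<Rightarrow> complex \<Rightarrow> complex \<Rightarrow> complex" where
  "dh_lattice \<gamma> \<delta> x = x * (x + \<gamma> + \<delta> + 1)"

text \<open>The factor \<open>(\<gamma> + 1)\<^sub>n (-N)\<^sub>n\<close> is cancelled termwise against the denominators of the
  hypergeometric series, so that every degree \<open>n\<close>, also \<open>n > N\<close>, is covered.\<close>

definition dual_hahn_sum :: "nat \<Rightarrow> complex \<Rightarrow> complex \<Rightarrow> complex \<Rightarrow> nat \<Rightarrow> complex" where
  "dual_hahn_sum n x \<gamma> \<delta> N =
     (\<Sum>k=0..n. pochhammer (- of_nat n) k * pochhammer (- x) k
                 * pochhammer (x + \<gamma> + \<delta> + 1) k / fact k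
                 * pochhammer (\<gamma> + 1 + of_nat k) (n - k)
                 * pochhammer (- of_nat N + of_nat k) (n - k))"

text \<open>The dual Hahn polynomial is a function of \<open>u = \<lambda>(x)\<close>, given by a formula in \<open>x\<close>
  that is invariant under \<open>x \<mapsto> - x - \<gamma> - \<delta> - 1\<close>; hence \<open>dual_hahn_lattice\<close> below.\<close>

definition dual_hahn :: "nat \<Rightarrow> complex \<Rightarrow> complex \<Rightarrow> complex \<Rightarrow> nat \<Rightarrow> complex" where
  "dual_hahn n u \<gamma> \<delta> N =
     (THE r. \<exists>x. u = dh_lattice \<gamma> \<delta> x \<and> r = dual_hahn_sum n x \<gamma> \<delta> N)"

lemma dual_hahn_lattice:
  "dual_hahn n (dh_lattice \<gamma> \<delta> x) \<gamma> \<delta> N = dual_hahn_sum n x \<gamma> \<delta> N"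
proof -
  have "dual_hahn_sum n x' \<gamma> \<delta> N = dual_hahn_sum n x \<gamma> \<delta> N"
    if "dh_lattice \<gamma> \<delta> x = dh_lattice \<gamma> \<delta> x'" for x'
  proof -
    have "(x - x') * (x + x' + \<gamma> + \<delta> + 1) = 0"
      using that by (simp add: dh_lattice_def algebra_simps)
    then consider "x' = x" | "x + x' + \<gamma> + \<delta> + 1 = 0"
      by auto
    then show ?thesis
    proof cases
      case 2
      have "- x' = x + \<gamma> + \<delta> + 1" "x' + \<gamma> + \<delta> + 1 = - x"
        using 2 by (simp_all add: algebra_simps eq_neg_iff_add_eq_0 neg_eq_iff_add_eq_0)
      then show ?thesis
        unfolding dual_hahn_sum_def by (simp add: mult_ac)
    qed simp
  qed
  then show ?thesis
    unfolding dual_hahn_def by (intro the_equality) blast+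
qed

definition cont_dual_hahn_sum ::
    "nat \<Rightarrow> complex \<Rightarrow> complex \<Rightarrow> complex \<Rightarrow> complex \<Rightarrow> complex" where
  "cont_dual_hahn_sum m y a b c =
     (-1) ^ m * (\<Sum>k=0..m. pochhammer (- of_nat m) k * pochhammer (a + \<i> * y) k
                 * pochhammer (a - \<i> * y) k / fact k
                 * pochhammer (a + b + of_nat k) (m - k)
                 * pochhammer (a + c + of_nat k) (m - k))"

text \<open>The continuous dual Hahn polynomial is likewise a function of \<open>z = y\<^sup>2\<close>.\<close>

definition cont_dual_hahn ::
    "nat \<Rightarrow> complex \<Rightarrow> complex \<Rightarrow> complex \<Rightarrow> complex \<Rightarrow> complex" where
  "cont_dual_hahn m z a b c = (THE s. \<exists>y. z = y\<^sup>2 \<and> s = cont_dual_hahn_sum m y a b c)"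

lemma cont_dual_hahn_square:
  "cont_dual_hahn m (y\<^sup>2) a b c = cont_dual_hahn_sum m y a b c"
proof -
  have "cont_dual_hahn_sum m y' a b c = cont_dual_hahn_sum m y a b c" if "y\<^sup>2 = y'\<^sup>2" for y'
  proof -
    consider "y' = y" | "y' = - y"
      using \<open>y\<^sup>2 = y'\<^sup>2\<close> by (auto simp: power2_eq_iff)
    then show ?thesis
      by cases (simp_all add: cont_dual_hahn_sum_def mult_ac)
  qed
  then show ?thesis
    unfolding cont_dual_hahn_def by (intro the_equality) blast+
qed

end

(* For k <= N < n the factor (-N + k)_{n-k} contains 0, so only the terms with k >= N + 1 survive.
   Shifting k by N + 1 and splitting (-x)_k and (x + \<gamma> + \<delta> + 1)_k after N + 1 factors leaves
   exactly the continuous dual Hahn sum of degree n - N - 1. The case n = N + 1, where that sum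
   is 1, identifies the common factor as R_{N+1}. *)

theory Submission
  imports Defs
begin

text \<open>The absolute value is the falling factorial, that is, \<open>k!\<close> times a binomial
  coefficient. Writing the integer Pochhammer symbols as factorials allows the two sums to be
  compared term by term.\<close>

lemma pochhammer_uminus_of_nat:
  assumes "k \<le> n"
  shows "pochhammer (- of_nat n :: 'a::field_char_0) k = (-1) ^ k * fact n / fact (n - k)"
proof -
  have "pochhammer (- of_nat n :: 'a) k = (-1) ^ k * fact k * (of_nat n gchoose k)"
    by (cases "even k") (simp_all add: gbinomial_pochhammer)
  also have "(of_nat n gchoose k :: 'a) = fact n / (fact k * fact (n - k))"
    using assms by (simp add: binomial_fact flip: binomial_gbinomial)
  finally show ?thesis
    by simp
qed

lemma pochhammer_Suc_of_nat:
  assumes "j \<le> m"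
  shows "pochhammer (of_nat (Suc j) :: 'a::field_char_0) (m - j) = fact m / fact j"
  using assms pochhammer_product[of j m "1 :: 'a"]
  by (simp add: field_simps flip: pochhammer_fact)

text \<open>The product starts at \<open>-(N - k)\<close> and has \<open>n - k > N - k\<close>
  factors, so it runs through 0.\<close>

lemma pochhammer_uminus_of_nat_add_eq_0:
  assumes "k \<le> N" "N < n"
  shows "pochhammer (- of_nat N + of_nat k :: 'a::{idom,ring_char_0}) (n - k) = 0"
proof -
  have "(- of_nat N + of_nat k :: 'a) = - of_nat (N - k)"
    using assms by (simp add: of_nat_diff)
  then show ?thesis
    using assms by (simp only: pochhammer_of_nat_eq_0_iff)
qed

text \<open>The sum on the right is already the continuous dual Hahn sum of degree \<open>m\<close>,
  without its sign and with \<open>a + iy\<close>, \<open>a - iy\<close>, \<open>a + b\<close>,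
  \<open>a + c\<close> evaluated.\<close>

lemma dual_hahn_sum_Suc_add:
  "dual_hahn_sum (Suc N + m) x \<gamma> \<delta> N =
     (-1) ^ Suc N * pochhammer (- x) (Suc N) * pochhammer (x + \<gamma> + \<delta> + 1) (Suc N) *
     (\<Sum>j=0..m. pochhammer (- of_nat m) j * pochhammer (of_nat (Suc N) - x) j
                 * pochhammer (x + \<gamma> + \<delta> + 1 + of_nat (Suc N)) j / fact j
                 * pochhammer (of_nat (Suc (Suc N + j))) (m - j)
                 * pochhammer (of_nat N + \<gamma> + 2 + of_nat j) (m - j))"
proof -
  let ?n = "Suc N + m"
  define t where "t k = pochhammer (- of_nat ?n) k * pochhammer (- x) k
    * pochhammer (x + \<gamma> + \<delta> + 1) k / fact k
    * pochhammer (\<gamma> + 1 + of_nat k) (?n - k) * pochhammer (- of_nat N + of_nat k) (?n - k)" for k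
  have "dual_hahn_sum ?n x \<gamma> \<delta> N = sum t {0..?n}"
    unfolding dual_hahn_sum_def t_def ..
  also have "\<dots> = sum t {Suc N..?n}"
  proof (rule sum.mono_neutral_right)
    show "\<forall>k\<in>{0..?n} - {Suc N..?n}. t k = 0"
    proof
      fix k assume "k \<in> {0..?n} - {Suc N..?n}"
      then have "pochhammer (- of_nat N + of_nat k :: complex) (?n - k) = 0"
        by (intro pochhammer_uminus_of_nat_add_eq_0) auto
      then show "t k = 0"
        by (simp only: t_def mult_zero_right)
    qed
  qed auto
  also have "\<dots> = (\<Sum>j=0..m. t (Suc N + j))"
    using sum.shift_bounds_cl_nat_ivl[of t 0 "Suc N" m] by (simp add: add.commute)
  also have "\<dots> = (\<Sum>j=0..m. (-1) ^ Suc N * pochhammer (- x) (Suc N)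
      * pochhammer (x + \<gamma> + \<delta> + 1) (Suc N)
      * (pochhammer (- of_nat m) j * pochhammer (of_nat (Suc N) - x) j
         * pochhammer (x + \<gamma> + \<delta> + 1 + of_nat (Suc N)) j / fact j
         * pochhammer (of_nat (Suc (Suc N + j))) (m - j)
         * pochhammer (of_nat N + \<gamma> + 2 + of_nat j) (m - j)))"
  proof (rule sum.cong[OF refl])
    fix j assume "j \<in> {0..m}"
    then have j: "j \<le> m" by simp
    define X Y A B G where "X = pochhammer (- x) (Suc N)"
      and "Y = pochhammer (x + \<gamma> + \<delta> + 1) (Suc N)"
      and "A = pochhammer (of_nat (Suc N) - x) j"
      and "B = pochhammer (x + \<gamma> + \<delta> + 1 + of_nat (Suc N)) j"
      and "G = pochhammer (of_nat N + \<gamma> + 2 + of_nat j) (m - j)"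
    have X: "pochhammer (- x) (Suc N + j) = X * A"
      unfolding X_def A_def by (subst pochhammer_product') (simp add: algebra_simps)
    have Y: "pochhammer (x + \<gamma> + \<delta> + 1) (Suc N + j) = Y * B"
      unfolding Y_def B_def by (rule pochhammer_product')
    have G: "pochhammer (\<gamma> + 1 + of_nat (Suc N + j)) (?n - (Suc N + j)) = G"
      unfolding G_def by (simp add: algebra_simps)
    have n: "pochhammer (- of_nat ?n :: complex) (Suc N + j) =
        (-1) ^ (Suc N + j) * fact ?n / fact (m - j)"
      using j by (subst pochhammer_uminus_of_nat) simp_all
    \<comment> \<open>Beyond \<open>k = N\<close> the symbol starts at the positive integer
      \<open>j + 1\<close>, so it no longer vanishes and is a quotient of factorials.\<close>
    have "(- of_nat N + of_nat (Suc N + j) :: complex) = of_nat (Suc j)"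
      by simp
    then have F: "pochhammer (- of_nat N + of_nat (Suc N + j) :: complex) (?n - (Suc N + j)) =
        fact m / fact j"
      using pochhammer_Suc_of_nat[OF j, where 'a = complex] by simp
    have F': "pochhammer (of_nat (Suc (Suc N + j)) :: complex) (m - j) = fact ?n / fact (Suc N + j)"
      using pochhammer_Suc_of_nat[of "Suc N + j" ?n, where 'a = complex] j by simp
    have m: "pochhammer (- of_nat m :: complex) j = (-1) ^ j * fact m / fact (m - j)"
      using j by (rule pochhammer_uminus_of_nat)
    \<comment> \<open>The integer factors trade places: \<open>n!/(N+1+j)!\<close>, from
      \<open>(-n)_k / k!\<close>, becomes \<open>(a+b+j)_{m-j}\<close>, while \<open>m!/j!\<close>,
      from \<open>(-N+k)_{n-k}\<close>, completes \<open>(-m)_j / j!\<close>.\<close>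
    show "t (Suc N + j) = (-1) ^ Suc N * pochhammer (- x) (Suc N)
      * pochhammer (x + \<gamma> + \<delta> + 1) (Suc N)
      * (pochhammer (- of_nat m) j * pochhammer (of_nat (Suc N) - x) j
         * pochhammer (x + \<gamma> + \<delta> + 1 + of_nat (Suc N)) j / fact j
         * pochhammer (of_nat (Suc (Suc N + j))) (m - j)
         * pochhammer (of_nat N + \<gamma> + 2 + of_nat j) (m - j))"
      unfolding t_def X Y G n F F' m X_def[symmetric] Y_def[symmetric] A_def[symmetric]
        B_def[symmetric] G_def[symmetric] power_add
      by (simp only: times_divide_eq_left times_divide_eq_right divide_divide_eq_left mult_ac)
  qed
  finally show ?thesis
    by (simp only: sum_distrib_left)
qed

theorem mainTheorem6:
  fixes N n :: nat and \<gamma> \<delta> x :: complex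
  assumes "n > N"
  shows "dual_hahn n (dh_lattice \<gamma> \<delta> x) \<gamma> \<delta> N =
    dual_hahn (N + 1) (dh_lattice \<gamma> \<delta> x) \<gamma> \<delta> N * (-1) ^ (n - N - 1) *
    cont_dual_hahn (n - N - 1) ((x * \<i> + \<i> * ((\<gamma> + \<delta> + 1) / 2))\<^sup>2)
      (of_nat N + (\<gamma> + \<delta> + 3) / 2) ((- \<gamma> - \<delta> + 1) / 2) ((\<gamma> - \<delta> + 1) / 2)"
proof -
  define m where "m = n - N - 1"
  have n: "n = Suc N + m"
    using assms by (simp add: m_def)
  define a b c y where "a = of_nat N + (\<gamma> + \<delta> + 3) / 2" and "b = (- \<gamma> - \<delta> + 1) / 2"
    and "c = (\<gamma> - \<delta> + 1) / 2" and "y = x * \<i> + \<i> * ((\<gamma> + \<delta> + 1) / 2)"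
  \<comment> \<open>Multiplying by \<open>\<i>\<close> makes \<open>iy\<close> free of the imaginary
    unit, and its half-shift cancels against the one in \<open>a\<close>.\<close>
  have "y = \<i> * (x + (\<gamma> + \<delta> + 1) / 2)"
    unfolding y_def distrib_left by (simp only: mult.commute)
  then have iy: "\<i> * y = - (x + (\<gamma> + \<delta> + 1) / 2)"
    by (simp only: mult.assoc[symmetric] i_squared mult_minus1)
  have args: "a + \<i> * y = of_nat (Suc N) - x" "a - \<i> * y = x + \<gamma> + \<delta> + 1 + of_nat (Suc N)"
    "a + c = of_nat N + \<gamma> + 2"
    unfolding iy by (simp_all add: a_def c_def field_simps)
  have "a + b = of_nat N + 2"
    by (simp add: a_def b_def add_divide_distrib diff_divide_distrib)
  then have ab: "a + b + of_nat j = of_nat (Suc (Suc N + j))" for j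
    by simp
  have R: "dual_hahn_sum (N + 1) x \<gamma> \<delta> N =
      (-1) ^ Suc N * pochhammer (- x) (Suc N) * pochhammer (x + \<gamma> + \<delta> + 1) (Suc N)"
    using dual_hahn_sum_Suc_add[of N 0 x \<gamma> \<delta>] by simp
  \<comment> \<open>The explicit \<open>(-1)^m\<close> cancels the sign built into the continuous
    dual Hahn sum.\<close>
  have "dual_hahn_sum n x \<gamma> \<delta> N =
      dual_hahn_sum (N + 1) x \<gamma> \<delta> N * (-1) ^ m * cont_dual_hahn_sum m y a b c"
    unfolding n dual_hahn_sum_Suc_add R cont_dual_hahn_sum_def args ab
    by (simp only: mult.assoc left_minus_one_mult_self)
  \<comment> \<open>Both polynomials are functions of \<open>\<lambda>(x)\<close> and
    \<open>y^2\<close>; their values are the sums at the representatives \<open>x\<close> and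
    \<open>y\<close>.\<close>
  then show ?thesis
    unfolding dual_hahn_lattice cont_dual_hahn_square m_def a_def b_def c_def y_def .
qed

end
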